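(* For any $\ell\geq 2$ and $n=2\ell+1$, if $D$ is a set of rainbow sequences such that $C(d)$ and $C(d')$ are edge-disjoint cycles in the graph $G_{n,2}^{C}$ for all $d,d'\in D$ with $d\neq d'$, then $|D|\leq n-3$.
   Context: Let $n=2\ell+1$ be odd. The graph $G_{n,2}^{C}$ has as vertices all 2-element subsets of $[n]=\{1,\dots,n\}$, with an edge between two subsets $A,B$ whenever $|A\setminus B|=|B\setminus A|=1$; the edge is labeled by the transposition $A\triangle B$. A (1-)rainbow cycle is a cycle along which every 2-element subset of $[n]$ appears exactly once as a transposition label. For $A\subseteq[n]$, $\sigma(A)$ is obtained by adding 1 to every element modulo $n$ (representatives $1,\dots,n$). For a pair $\{x,y\}$, $\mathrm{dist}(\{x,y\}):=\min\{y-x,x-y\}\in[\ell]$, differences taken modulo $n$. A sequence $d=(d_1,\dots,d_\ell)$ of integers with $-\ell\leq d_i\leq \ell$ is a rainbow sequence if, setting $b_1:=n$, $b_{i+1}:=b_i+d_i \bmod n$ for $i\in[\ell-1]$, and $B_i:=\{1,b_i\}$, the following hold: (a) $3\leq b_i\leq n$ for all $i\in[\ell]$ (and $b_1=n$); (b) $\{\mathrm{dist}(B_i)\mid i\in[\ell]\}=[\ell]$; (c) $\{\mathrm{dist}(B_i\triangle B_{i+1})\mid i\in[\ell-1]\}\cup\{\mathrm{dist}(B_\ell\triangle\sigma(B_1))\}=[\ell]$; and moreover $\mathrm{dist}(\{b_\ell,2\})=|d_\ell|$. For such $d$, with $B=(B_1,\dots,B_\ell)$, $C(d)$ denotes the cyclic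 sequence $(B,\sigma^1(B),\sigma^2(B),\dots,\sigma^{2\ell}(B))$, which is a rainbow Hamilton cycle in $G_{n,2}^{C}$. *)

theory Defs
  imports Main
begin

text \<open>The ground set \<open>[n]\<close> is \<open>{1..int n}\<close>; residues modulo \<open>n\<close> are represented by
  \<open>1, \<dots>, n\<close>.\<close>

definition residue_rep :: "nat \<Rightarrow> int \<Rightarrow> int" where
  "residue_rep n x = (x - 1) mod int n + 1"

definition G_vertices :: "nat \<Rightarrow> int set set" where
  "G_vertices n = {A. A \<subseteq> {1..int n} \<and> card A = 2}"

definition G_edges :: "nat \<Rightarrow> int set set set" where
  "G_edges n = {{A, B} | A B. A \<in> G_vertices n \<and> B \<in> G_vertices n \<and>
                  card (A - B) = 1 \<and> card (B - A) = 1}"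

text \<open>A cyclic sequence is a list whose last entry is followed by its first one.\<close>

definition cyclic_edges :: "'a list \<Rightarrow> 'a set set" where
  "cyclic_edges xs = {{xs ! i, xs ! (Suc i mod length xs)} | i. i < length xs}"

definition cycle_in_G :: "nat \<Rightarrow> int set list \<Rightarrow> bool" where
  "cycle_in_G n xs \<longleftrightarrow>
     length xs \<ge> 3 \<and> distinct xs \<and> set xs \<subseteq> G_vertices n \<and> cyclic_edges xs \<subseteq> G_edges n"

definition edge_disjoint_cycles_in_G :: "nat \<Rightarrow> int set list \<Rightarrow> int set list \<Rightarrow> bool" where
  "edge_disjoint_cycles_in_G n xs ys \<longleftrightarrow>
     cycle_in_G n xs \<and> cycle_in_G n ys \<and> cyclic_edges xs \<inter> cyclic_edges ys = {}"

definition sigma :: "nat \<Rightarrow> int set \<Rightarrow> int set" where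
  "sigma n A = (\<lambda>x. residue_rep n (x + 1)) ` A"

text \<open>Meaningful only for two-element sets. In \<open>rainbow_sequence\<close> below, the range of \<open>b\<close> makes
  every \<open>B\<^sub>i\<close> a pair, and the distance condition on the \<open>B\<^sub>i\<close> makes them pairwise distinct,
  so that the symmetric differences are pairs as well.\<close>

definition pair_dist :: "nat \<Rightarrow> int set \<Rightarrow> int" where
  "pair_dist n A =
     (THE k. \<exists>x y. A = {x, y} \<and> x \<noteq> y \<and> k = min ((y - x) mod int n) ((x - y) mod int n))"

text \<open>Sequences are 0-based lists: \<open>d ! i\<close> is $d_{i+1}$, \<open>b_seq n d i\<close> is $b_{i+1}$ and
  \<open>B_seq n d i\<close> is $B_{i+1}$.\<close>

fun b_seq :: "nat \<Rightarrow> int list \<Rightarrow> nat \<Rightarrow> int" where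
  "b_seq n d 0 = int n"
| "b_seq n d (Suc i) = residue_rep n (b_seq n d i + d ! i)"

definition B_seq :: "nat \<Rightarrow> int list \<Rightarrow> nat \<Rightarrow> int set" where
  "B_seq n d i = {1, b_seq n d i}"

definition rainbow_sequence :: "nat \<Rightarrow> int list \<Rightarrow> bool" where
  "rainbow_sequence l d \<longleftrightarrow>
     (let n = 2 * l + 1; b = b_seq n d; B = B_seq n d in
        length d = l \<and>
        (\<forall>i<l. - int l \<le> d ! i \<and> d ! i \<le> int l) \<and>
        (\<forall>i<l. 3 \<le> b i \<and> b i \<le> int n) \<and>
        {pair_dist n (B i) | i. i < l} = {1..int l} \<and>
        {pair_dist n (sym_diff (B i) (B (Suc i))) | i. i < l - 1}
          \<union> {pair_dist n (sym_diff (B (l - 1)) (sigma n (B 0)))} = {1..int l} \<and>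
        pair_dist n {b (l - 1), 2} = \<bar>d ! (l - 1)\<bar>)"

definition C_cycle :: "nat \<Rightarrow> int list \<Rightarrow> int set list" where
  "C_cycle l d =
     (let n = 2 * l + 1; B = map (B_seq n d) [0..<l] in
        concat (map (\<lambda>k. map (sigma n ^^ k) B) [0..<n]))"

end

theory Submission
  imports Defs
begin

text \<open>The edge that leaves the first block of \<open>C(d)\<close> joins \<open>{1, b\<^sub>\<ell>}\<close> to \<open>\<sigma>(B\<^sub>1) = {1, 2}\<close>, so it
  depends on \<open>b\<^sub>\<ell>\<close> only, and edge-disjointness makes \<open>d \<mapsto> b\<^sub>\<ell>\<close> injective on \<open>D\<close>. The \<open>\<ell>\<close> sets
  \<open>B\<^sub>i\<close> have \<open>\<ell>\<close> distinct distances, hence \<open>b\<^sub>\<ell> \<noteq> b\<^sub>1 = n\<close>, which leaves the \<open>n - 3\<close> values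
  \<open>3, \<dots>, n - 1\<close>.\<close>

lemma exit_edge_in_C_cycle:
  assumes "l \<ge> 1" and "n = 2 * l + 1"
  shows "{B_seq n d (l - 1), sigma n (B_seq n d 0)} \<in> cyclic_edges (C_cycle l d)"
proof -
  \<comment> \<open>Only the seam between the first two blocks matters; \<open>zs\<close> holds the
    rest.\<close>
  obtain zs where C: "C_cycle l d = map (B_seq n d) [0..<l] @ map (sigma n) (map (B_seq n d) [0..<l]) @ zs"
  proof
    have "[0..<n] = 0 # 1 # [2..<n]"
      using assms by (simp add: upt_conv_Cons numeral_2_eq_2)
    then show "C_cycle l d = map (B_seq n d) [0..<l] @ map (sigma n) (map (B_seq n d) [0..<l]) @
        concat (map (\<lambda>k. map (sigma n ^^ k) (map (B_seq n d) [0..<l])) [2..<n])"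
      unfolding C_cycle_def Let_def assms(2)[symmetric] by simp
  qed
  \<comment> \<open>Index \<open>l\<close> lies within the list, so the successor of
    \<open>l - 1\<close> does not wrap around.\<close>
  have "l < length (C_cycle l d)"
    using assms(1) by (simp add: C)
  moreover have "C_cycle l d ! (l - 1) = B_seq n d (l - 1)"
    and "C_cycle l d ! l = sigma n (B_seq n d 0)"
    using assms(1) by (simp_all add: C nth_append)
  ultimately show ?thesis
    unfolding cyclic_edges_def using assms(1)
    by (intro CollectI exI[of _ "l - 1"]) simp
qed

lemma rainbow_sequence_last_b_bounds:
  assumes "l \<ge> 2" and "n = 2 * l + 1" and "rainbow_sequence l d"
  shows "b_seq n d (l - 1) \<in> {3..<int n}"
proof -
  have range: "\<forall>i<l. 3 \<le> b_seq n d i \<and> b_seq n d i \<le> int n"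
    and "{pair_dist n (B_seq n d i) | i. i < l} = {1..int l}"
    using assms(3) unfolding rainbow_sequence_def Let_def assms(2)[symmetric] by blast+
  then have "(\<lambda>i. pair_dist n (B_seq n d i)) ` {..<l} = {1..int l}"
    by blast
  \<comment> \<open>A map from \<open>l\<close> indices onto \<open>l\<close> values cannot repeat a
    value.\<close>
  then have "inj_on (\<lambda>i. pair_dist n (B_seq n d i)) {..<l}"
    by (intro eq_card_imp_inj_on) simp_all
  \<comment> \<open>Since \<open>b_seq n d 0 = int n\<close>, equality would force
    \<open>l - 1 = 0\<close>, against \<open>l \<ge> 2\<close>.\<close>
  from inj_onD[OF this, of "l - 1" 0] have "b_seq n d (l - 1) \<noteq> int n"
    using assms(1) by (auto simp: B_seq_def)
  moreover have "3 \<le> b_seq n d (l - 1) \<and> b_seq n d (l - 1) \<le> int n"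
    using range assms(1) by simp
  ultimately show ?thesis by simp
qed

theorem theorem16:
  fixes l n :: nat and D :: "int list set"
  assumes "l \<ge> 2" and "n = 2 * l + 1"
    and "\<forall>d\<in>D. rainbow_sequence l d"
    and "\<forall>d\<in>D. \<forall>d'\<in>D. d \<noteq> d' \<longrightarrow>
           edge_disjoint_cycles_in_G n (C_cycle l d) (C_cycle l d')"
  shows "finite D \<and> card D \<le> n - 3"
proof -
  let ?f = "\<lambda>d. b_seq n d (l - 1)"
  have inj: "inj_on ?f D"
  proof (rule inj_onI, rule ccontr)
    fix d d' assume D: "d \<in> D" "d' \<in> D" and eq: "?f d = ?f d'" and "d \<noteq> d'"
    then have "cyclic_edges (C_cycle l d) \<inter> cyclic_edges (C_cycle l d') = {}"
      using assms(4) unfolding edge_disjoint_cycles_in_G_def by blast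
    \<comment> \<open>\<open>B_seq n d 0\<close> is \<open>{1, int n}\<close> for every
      \<open>d\<close>, so the second endpoints agree.\<close>
    moreover have "{B_seq n d (l - 1), sigma n (B_seq n d 0)} =
        {B_seq n d' (l - 1), sigma n (B_seq n d' 0)}"
      using eq by (simp add: B_seq_def)
    moreover have "l \<ge> 1" using assms(1) by simp
    ultimately show False
      using exit_edge_in_C_cycle[OF _ assms(2), of d] exit_edge_in_C_cycle[OF _ assms(2), of d']
      by auto
  qed
  have sub: "?f ` D \<subseteq> {3..<int n}"
    using rainbow_sequence_last_b_bounds[OF assms(1,2)] assms(3) by blast
  have "finite D"
    using inj_on_finite[OF inj sub] by simp
  moreover have "card D \<le> n - 3"
    using card_inj_on_le[OF inj sub] by simp
  ultimately show ?thesis ..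
qed

end
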